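(* Let $\mathcal{R}$ be an integral domain and let $\Gamma$ be a graph of type $A_n$, $n\ge 1$, with any orientation of its edges. Then the representation $R_1$ of the Hecke-Kiselman monoid $HK_{\Gamma}$ over $\mathcal{R}$ (the representation $R_f$ for the weight function $f$ constantly equal to $1$) is effective, i.e. $R_1([\mathbf{w}])\neq R_1([\mathbf{w}'])$ whenever $[\mathbf{w}]\ne[\mathbf{w}']$ in $HK_\Gamma$.
   Context: A graph of type $A_n$ is a directed graph with vertices $v_1,\dots,v_n$ such that for each $i\in\{1,\dots,n-1\}$ there is exactly one directed edge between $v_i$ and $v_{i+1}$ (either $v_i\to v_{i+1}$ or $v_{i+1}\to v_i$), and there are no other edges. For a finite directed graph $\Gamma$ without loops and with at most one directed edge between any pair of vertices, the Hecke-Kiselman monoid $HK_\Gamma$ is the quotient of the free monoid $V(\Gamma)^*$ on the vertex set by the relations: $x^2=x$ for all $x\in V(\Gamma)$; $xy=yx$ if there is no edge between $x$ and $y$; $xyx=yxy=xy$ if there is an edge $x\to y$. The class of a word $\mathbf{w}$ is denoted $[\mathbf{w}]$. Let $W=\bigoplus_{v\in V(\Gamma)}\mathcal{R}v$ be the free $\mathcal{R}$-module with basis $V(\Gamma)$. A weight function is a function $f:E(\Gamma)\to\mathcal{R}\setminus\{0\}$; write $f_{xy}$ for the weight of the edge $x\to y$. For $x\in V(\Gamma)$ let $\theta_x^f\in \mathrm{End}_{\mathcal{R}}(W)$ be the linear map with $\theta_x^f(y)=y$ for vertices $y\neq x$ and $\theta_x^f(x)=\sum_{z\to x}f_{zx}z$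 (an empty sum is $0$). The assignment $x\mapsto\theta_x^f$ extends to a monoid homomorphism $R_f:HK_\Gamma\to \mathrm{End}_{\mathcal{R}}(W)$ (the product being composition, so $R_f([xy])=\theta^f_x\circ\theta^f_y$). A representation is effective if it is injective as a map on $HK_\Gamma$. *)

theory Defs
  imports "Graph_Theory.Pair_Digraph" "HOL-Algebra.Module"
begin

section \<open>Graphs\<close>

text \<open>
  Arcs are ordered pairs of vertices, so there is at most one arc in each direction between
  two vertices, and antisymmetry excludes a pair of opposite arcs.
\<close>

locale simple_digraph = pair_digraph G for G :: "'v pair_pre_digraph" +
  assumes one_arc: "(x, y) \<in> parcs G \<Longrightarrow> (y, x) \<notin> parcs G"

text \<open>In \<open>type_A\<close>, inequality of the two truth values says that exactly one of the two arcs exists.\<close>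

definition type_A :: "nat \<Rightarrow> 'v pair_pre_digraph \<Rightarrow> bool" where
  "type_A n G \<longleftrightarrow> (\<exists>v. bij_betw v {1..n} (pverts G)
     \<and> (\<forall>i\<in>{1..<n}. ((v i, v (Suc i)) \<in> parcs G) \<noteq> ((v (Suc i), v i) \<in> parcs G))
     \<and> (\<forall>(x, y)\<in>parcs G. \<exists>i\<in>{1..<n}. {x, y} = {v i, v (Suc i)}))"


section \<open>The Hecke-Kiselman monoid\<close>

text \<open>
  The free monoid on the vertices is the set of words \<open>lists (pverts G)\<close> under concatenation.
  \<open>HK_cong G\<close> is the monoid congruence on it generated by the defining relations.
\<close>

inductive_set HK_cong :: "'v pair_pre_digraph \<Rightarrow> ('v list \<times> 'v list) set"
  for G :: "'v pair_pre_digraph" where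
  refl: "u \<in> lists (pverts G) \<Longrightarrow> (u, u) \<in> HK_cong G"
| sym: "(u, v) \<in> HK_cong G \<Longrightarrow> (v, u) \<in> HK_cong G"
| trans: "(u, v) \<in> HK_cong G \<Longrightarrow> (v, w) \<in> HK_cong G \<Longrightarrow> (u, w) \<in> HK_cong G"
| append: "(u, u') \<in> HK_cong G \<Longrightarrow> (v, v') \<in> HK_cong G \<Longrightarrow> (u @ v, u' @ v') \<in> HK_cong G"
| idem: "x \<in> pverts G \<Longrightarrow> ([x, x], [x]) \<in> HK_cong G"
| comm: "x \<in> pverts G \<Longrightarrow> y \<in> pverts G \<Longrightarrow> (x, y) \<notin> parcs G \<Longrightarrow> (y, x) \<notin> parcs G \<Longrightarrow>
    ([x, y], [y, x]) \<in> HK_cong G"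
| arc_left: "x \<in> pverts G \<Longrightarrow> y \<in> pverts G \<Longrightarrow> (x, y) \<in> parcs G \<Longrightarrow>
    ([x, y, x], [x, y]) \<in> HK_cong G"
| arc_right: "x \<in> pverts G \<Longrightarrow> y \<in> pverts G \<Longrightarrow> (x, y) \<in> parcs G \<Longrightarrow>
    ([y, x, y], [x, y]) \<in> HK_cong G"

definition HK_class :: "'v pair_pre_digraph \<Rightarrow> 'v list \<Rightarrow> 'v list set" where
  "HK_class G w = HK_cong G `` {w}"

definition HK :: "'v pair_pre_digraph \<Rightarrow> 'v list set monoid" where
  "HK G = \<lparr>carrier = lists (pverts G) // HK_cong G,
     mult = (\<lambda>A B. \<Union>u\<in>A. \<Union>v\<in>B. HK_class G (u @ v)),
     one = HK_class G []\<rparr>"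

lemma HK_cong_words:
  "(u, v) \<in> HK_cong G \<Longrightarrow> u \<in> lists (pverts G) \<and> v \<in> lists (pverts G)"
  by (induction rule: HK_cong.induct) auto

lemma equiv_HK_cong: "equiv (lists (pverts G)) (HK_cong G)"
proof (rule equivI)
  show "refl_on (lists (pverts G)) (HK_cong G)"
    by (rule refl_onI) (rule HK_cong.refl)
  show "HK_cong G \<subseteq> lists (pverts G) \<times> lists (pverts G)"
    using HK_cong_words by fastforce
  show "Relation.sym (HK_cong G)"
    by (rule symI) (rule HK_cong.sym)
  show "Relation.trans (HK_cong G)"
    by (rule transI) (rule HK_cong.trans)
qed

lemma HK_class_eq_iff:
  "u \<in> lists (pverts G) \<Longrightarrow> v \<in> lists (pverts G) \<Longrightarrow>
    HK_class G u = HK_class G v \<longleftrightarrow> (u, v) \<in> HK_cong G"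
  unfolding HK_class_def by (rule eq_equiv_class_iff [OF equiv_HK_cong])

lemma carrier_HK: "carrier (HK G) = HK_class G ` lists (pverts G)"
  by (auto simp: HK_def HK_class_def quotient_def)

lemma HK_mult_class:
  assumes "u \<in> lists (pverts G)" "v \<in> lists (pverts G)"
  shows "HK_class G u \<otimes>\<^bsub>HK G\<^esub> HK_class G v = HK_class G (u @ v)"
proof -
  have *: "HK_class G (u' @ v') = HK_class G (u @ v)"
    if "u' \<in> HK_class G u" "v' \<in> HK_class G v" for u' v'
  proof -
    have "(u @ v, u' @ v') \<in> HK_cong G"
      using that by (auto simp: HK_class_def intro: HK_cong.append)
    then show ?thesis
      using HK_cong_words [of "u @ v" "u' @ v'" G] by (metis HK_class_eq_iff)
  qed
  have "u \<in> HK_class G u" "v \<in> HK_class G v"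
    using assms by (auto simp: HK_class_def intro: HK_cong.refl)
  then show ?thesis
    unfolding HK_def by simp (blast dest: *)
qed

lemma monoid_HK: "monoid (HK G)"
proof (rule monoidI)
  have one: "\<one>\<^bsub>HK G\<^esub> = HK_class G []"
    by (simp add: HK_def)
  show "\<one>\<^bsub>HK G\<^esub> \<in> carrier (HK G)"
    by (auto simp: one carrier_HK)
  fix A B C
  assume "A \<in> carrier (HK G)" "B \<in> carrier (HK G)"
  then obtain u v where u: "u \<in> lists (pverts G)" "A = HK_class G u"
    and v: "v \<in> lists (pverts G)" "B = HK_class G v"
    unfolding carrier_HK by blast
  have uv: "u @ v \<in> lists (pverts G)"
    using u v by auto
  show "A \<otimes>\<^bsub>HK G\<^esub> B \<in> carrier (HK G)"
    using u v uv by (simp add: HK_mult_class carrier_HK)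
  assume "C \<in> carrier (HK G)"
  then obtain w where w: "w \<in> lists (pverts G)" "C = HK_class G w"
    unfolding carrier_HK by blast
  have vw: "v @ w \<in> lists (pverts G)"
    using w v by auto
  show "A \<otimes>\<^bsub>HK G\<^esub> B \<otimes>\<^bsub>HK G\<^esub> C = A \<otimes>\<^bsub>HK G\<^esub> (B \<otimes>\<^bsub>HK G\<^esub> C)"
    using u v w uv vw by (simp add: HK_mult_class)
next
  fix A
  assume "A \<in> carrier (HK G)"
  then obtain u where u: "u \<in> lists (pverts G)" "A = HK_class G u"
    unfolding carrier_HK by blast
  have one: "\<one>\<^bsub>HK G\<^esub> = HK_class G []"
    by (simp add: HK_def)
  show "\<one>\<^bsub>HK G\<^esub> \<otimes>\<^bsub>HK G\<^esub> A = A" "A \<otimes>\<^bsub>HK G\<^esub> \<one>\<^bsub>HK G\<^esub> = A"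
    using HK_mult_class [of "[]" G u] HK_mult_class [of u G "[]"] u by (simp_all add: one)
qed


section \<open>Free modules and endomorphisms\<close>

text \<open>
  Elements of the free module on a finite set \<open>V\<close> are coefficient families, extensional outside
  \<open>V\<close>. The ring multiplication and unit fields of the module record play no role.
\<close>

definition free_module :: "('r, 'm) ring_scheme \<Rightarrow> 'v set \<Rightarrow> ('r, 'v \<Rightarrow> 'r) module" where
  "free_module R V =
    \<lparr>carrier = V \<rightarrow>\<^sub>E carrier R, mult = undefined, one = undefined,
     zero = (\<lambda>v\<in>V. \<zero>\<^bsub>R\<^esub>),
     add = (\<lambda>a b. \<lambda>v\<in>V. a v \<oplus>\<^bsub>R\<^esub> b v),
     smult = (\<lambda>c a. \<lambda>v\<in>V. c \<otimes>\<^bsub>R\<^esub> a v)\<rparr>"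

definition basis_vec :: "('r, 'm) ring_scheme \<Rightarrow> 'v set \<Rightarrow> 'v \<Rightarrow> 'v \<Rightarrow> 'r" where
  "basis_vec R V x = (\<lambda>v\<in>V. if v = x then \<one>\<^bsub>R\<^esub> else \<zero>\<^bsub>R\<^esub>)"

definition End_monoid ::
    "('r, 'm) ring_scheme \<Rightarrow> ('r, 'a, 'n) module_scheme \<Rightarrow> ('a \<Rightarrow> 'a) monoid" where
  "End_monoid R M =
    \<lparr>carrier = {\<phi> \<in> carrier M \<rightarrow>\<^sub>E carrier M.
       (\<forall>a\<in>carrier M. \<forall>b\<in>carrier M. \<phi> (a \<oplus>\<^bsub>M\<^esub> b) = \<phi> a \<oplus>\<^bsub>M\<^esub> \<phi> b)
     \<and> (\<forall>c\<in>carrier R. \<forall>a\<in>carrier M. \<phi> (c \<odot>\<^bsub>M\<^esub> a) = c \<odot>\<^bsub>M\<^esub> \<phi> a)},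
     mult = compose (carrier M),
     one = (\<lambda>a\<in>carrier M. a)\<rparr>"


section \<open>The representations\<close>

definition weight_function ::
    "('r, 'm) ring_scheme \<Rightarrow> 'v pair_pre_digraph \<Rightarrow> ('v \<times> 'v \<Rightarrow> 'r) \<Rightarrow> bool" where
  "weight_function R G f \<longleftrightarrow> f \<in> parcs G \<rightarrow> carrier R - {\<zero>\<^bsub>R\<^esub>}"

abbreviation HK_space :: "('r, 'm) ring_scheme \<Rightarrow> 'v pair_pre_digraph \<Rightarrow> ('r, 'v \<Rightarrow> 'r) module" where
  "HK_space R G \<equiv> free_module R (pverts G)"

definition theta_basis ::
    "('r, 'm) ring_scheme \<Rightarrow> 'v pair_pre_digraph \<Rightarrow> ('v \<times> 'v \<Rightarrow> 'r) \<Rightarrow> 'v \<Rightarrow> 'v \<Rightarrow> 'v \<Rightarrow> 'r" where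
  "theta_basis R G f x y =
    (if y = x
     then (\<Oplus>\<^bsub>HK_space R G\<^esub> z \<in> {z \<in> pverts G. (z, x) \<in> parcs G}.
             f (z, x) \<odot>\<^bsub>HK_space R G\<^esub> basis_vec R (pverts G) z)
     else basis_vec R (pverts G) y)"

text \<open>\<open>theta R G f x\<close> is the linear extension of \<open>theta_basis R G f x\<close>.\<close>

definition theta ::
    "('r, 'm) ring_scheme \<Rightarrow> 'v pair_pre_digraph \<Rightarrow> ('v \<times> 'v \<Rightarrow> 'r) \<Rightarrow> 'v \<Rightarrow> ('v \<Rightarrow> 'r) \<Rightarrow> 'v \<Rightarrow> 'r" where
  "theta R G f x =
    (\<lambda>a\<in>carrier (HK_space R G).
       \<Oplus>\<^bsub>HK_space R G\<^esub> y \<in> pverts G. a y \<odot>\<^bsub>HK_space R G\<^esub> theta_basis R G f x y)"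

definition word_rep ::
    "('r, 'm) ring_scheme \<Rightarrow> 'v pair_pre_digraph \<Rightarrow> ('v \<times> 'v \<Rightarrow> 'r) \<Rightarrow> 'v list \<Rightarrow> ('v \<Rightarrow> 'r) \<Rightarrow> 'v \<Rightarrow> 'r" where
  "word_rep R G f w =
    foldr (\<lambda>x \<phi>. theta R G f x \<otimes>\<^bsub>End_monoid R (HK_space R G)\<^esub> \<phi>) w \<one>\<^bsub>End_monoid R (HK_space R G)\<^esub>"

text \<open>
  \<open>HK_rep R G f\<close> takes a congruence class to the common value of \<open>word_rep R G f\<close> on its words;
  see \<open>HK_rep_class\<close> and \<open>HK_rep_hom\<close> below.
\<close>

definition HK_rep ::
    "('r, 'm) ring_scheme \<Rightarrow> 'v pair_pre_digraph \<Rightarrow> ('v \<times> 'v \<Rightarrow> 'r) \<Rightarrow> 'v list set \<Rightarrow> ('v \<Rightarrow> 'r) \<Rightarrow> 'v \<Rightarrow> 'r" where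
  "HK_rep R G f A = the_elem (word_rep R G f ` A)"


section \<open>Well-definedness\<close>

lemma type_A_simple_digraph:
  assumes "type_A n G"
  shows "simple_digraph G"
proof -
  obtain v where bij: "bij_betw v {1..n} (pverts G)"
    and ones: "\<forall>i\<in>{1..<n}. ((v i, v (Suc i)) \<in> parcs G) \<noteq> ((v (Suc i), v i) \<in> parcs G)"
    and onlys: "\<forall>(x, y)\<in>parcs G. \<exists>i\<in>{1..<n}. {x, y} = {v i, v (Suc i)}"
    using assms unfolding type_A_def by (elim exE conjE)
  have one: "((v i, v (Suc i)) \<in> parcs G) \<noteq> ((v (Suc i), v i) \<in> parcs G)"
    if "i \<in> {1..<n}" for i
    using ones that by (rule bspec)
  have only: "\<exists>i\<in>{1..<n}. {x, y} = {v i, v (Suc i)}" if "(x, y) \<in> parcs G" for x y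
    using bspec [OF onlys that] by simp
  have inV: "v i \<in> pverts G" if "i \<in> {1..n}" for i
    using bij that bij_betwE by blast
  have arcs: "x \<in> pverts G \<and> y \<in> pverts G \<and> x \<noteq> y \<and> (y, x) \<notin> parcs G"
    if xy: "(x, y) \<in> parcs G" for x y
  proof -
    obtain i where i: "i \<in> {1..<n}" "{x, y} = {v i, v (Suc i)}"
      using only [OF xy] by blast
    have "v i \<noteq> v (Suc i)"
    proof
      assume "v i = v (Suc i)"
      then have "i = Suc i"
        using bij i(1) by (intro inj_onD [of v "{1..n}"]) (auto simp: bij_betw_def)
      then show False by simp
    qed
    then show ?thesis
      using i one [OF i(1)] xy inV [of i] inV [of "Suc i"] by (auto simp: doubleton_eq_iff)
  qed
  have fin: "finite (pverts G)"
    using bij bij_betw_finite by blast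
  have "parcs G \<subseteq> pverts G \<times> pverts G"
    using arcs by auto
  with fin have "finite (parcs G)"
    by (meson finite_SigmaI finite_subset)
  with fin arcs show ?thesis
    by unfold_locales (metis prod.collapse)+
qed

lemma module_free_module:
  assumes "cring R"
  shows "module R (free_module R V)"
proof -
  interpret cring R by fact
  show ?thesis
  proof (rule moduleI)
    show "cring R" by fact
    show "abelian_group (free_module R V)"
    proof (rule abelian_groupI)
      fix a assume a: "a \<in> carrier (free_module R V)"
      show "\<exists>b\<in>carrier (free_module R V). b \<oplus>\<^bsub>free_module R V\<^esub> a = \<zero>\<^bsub>free_module R V\<^esub>"
        by (rule bexI [of _ "\<lambda>v\<in>V. \<ominus>\<^bsub>R\<^esub> a v"])
          (use a in \<open>auto simp: free_module_def PiE_iff l_neg intro!: restrict_ext\<close>)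
      show "\<zero>\<^bsub>free_module R V\<^esub> \<oplus>\<^bsub>free_module R V\<^esub> a = a"
        using a by (auto simp: free_module_def PiE_iff fun_eq_iff extensional_def)
    qed (auto simp: free_module_def PiE_iff fun_eq_iff a_ac)
  qed (auto simp: free_module_def PiE_iff l_distr r_distr m_assoc fun_eq_iff extensional_def)
qed

lemma monoid_End_monoid:
  assumes "module R M"
  shows "monoid (End_monoid R M)"
proof -
  interpret module R M by fact
  show ?thesis
    by (rule monoidI)
      (auto simp: End_monoid_def compose_def PiE_iff extensional_def fun_eq_iff)
qed

locale HK_weighted = simple_digraph G + R: cring R
  for G :: "'v pair_pre_digraph" and R :: "('r, 'm) ring_scheme" (structure) +
  fixes f :: "'v \<times> 'v \<Rightarrow> 'r"
  assumes weight: "weight_function R G f"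
begin

abbreviation "V \<equiv> pverts G"
abbreviation "W \<equiv> HK_space R G"
abbreviation "EndW \<equiv> End_monoid R W"

lemma f_closed: "(x, y) \<in> parcs G \<Longrightarrow> f (x, y) \<in> carrier R"
  using weight by (auto simp: weight_function_def)

lemma W_carrier: "carrier W = V \<rightarrow>\<^sub>E carrier R"
  by (simp add: free_module_def)

sublocale W: module R W
  by (rule module_free_module) (rule R.is_cring)

lemma basis_closed: "basis_vec R V x \<in> carrier W"
  by (auto simp: basis_vec_def W_carrier)

lemma finsum_coord:
  assumes "finite A" "g \<in> A \<rightarrow> carrier W" "v \<in> V"
  shows "(\<Oplus>\<^bsub>W\<^esub> a \<in> A. g a) v = (\<Oplus> a \<in> A. g a v)"
  using assms
proof (induction A rule: finite_induct)
  case empty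
  have "\<zero>\<^bsub>W\<^esub> v = \<zero>"
    using empty.prems by (simp add: free_module_def)
  then show ?case by simp
next
  case (insert x F)
  have *: "(\<lambda>a. g a v) \<in> F \<rightarrow> carrier R" "g x v \<in> carrier R"
    using insert.prems by (auto simp: W_carrier)
  have "(\<Oplus>\<^bsub>W\<^esub> a \<in> insert x F. g a) v = (g x \<oplus>\<^bsub>W\<^esub> (\<Oplus>\<^bsub>W\<^esub> a \<in> F. g a)) v"
    using insert by (subst W.finsum_insert) auto
  also have "\<dots> = g x v \<oplus> (\<Oplus>\<^bsub>W\<^esub> a \<in> F. g a) v"
    using insert.prems by (simp add: free_module_def)
  also have "\<dots> = (\<Oplus> a \<in> insert x F. g a v)"
    using insert * by (subst R.finsum_insert) auto
  finally show ?case .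
qed

lemma theta_basis_closed: "theta_basis R G f x y \<in> carrier W"
  by (auto simp: theta_basis_def basis_closed f_closed intro!: W.finsum_closed)

lemma W_coord_closed: "a \<in> carrier W \<Longrightarrow> v \<in> V \<Longrightarrow> a v \<in> carrier R"
  by (auto simp: W_carrier)

lemma theta_closed: "a \<in> carrier W \<Longrightarrow> theta R G f x a \<in> carrier W"
  by (simp add: theta_def W_coord_closed theta_basis_closed)

lemma theta_basis_self_coord:
  assumes "v \<in> V"
  shows "theta_basis R G f x x v = (if (v, x) \<in> parcs G then f (v, x) else \<zero>)"
proof -
  let ?A = "{z \<in> V. (z, x) \<in> parcs G}"
  have fin: "finite ?A"
    using pair_finite_verts by simp
  have "theta_basis R G f x x v = (\<Oplus> z \<in> ?A. (f (z, x) \<odot>\<^bsub>W\<^esub> basis_vec R V z) v)"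
    using assms fin by (simp add: theta_basis_def finsum_coord basis_closed f_closed)
  also have "\<dots> = (\<Oplus> z \<in> ?A. if v = z then f (z, x) else \<zero>)"
    using assms by (intro R.finsum_cong') (auto simp: free_module_def basis_vec_def f_closed)
  also have "\<dots> = (if (v, x) \<in> parcs G then f (v, x) else \<zero>)"
  proof (cases "v \<in> ?A")
    case True
    then show ?thesis
      using R.finsum_singleton [OF True fin, of "\<lambda>z. f (z, x)"] by (auto simp: f_closed)
  next
    case False
    then have "(\<Oplus> z \<in> ?A. if v = z then f (z, x) else \<zero>) = (\<Oplus> z \<in> ?A. \<zero>)"
      by (intro R.finsum_cong') auto
    with False assms show ?thesis
      by simp
  qed
  finally show ?thesis .
qed

lemma theta_coord:
  assumes a: "a \<in> carrier W" and x: "x \<in> V" and v: "v \<in> V"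
  shows "theta R G f x a v =
    (if v = x then \<zero> else if (v, x) \<in> parcs G then a v \<oplus> a x \<otimes> f (v, x) else a v)"
proof -
  have ac: "\<And>y. y \<in> V \<Longrightarrow> a y \<in> carrier R"
    using a by (auto simp: W_carrier)
  have nl: "(x, x) \<notin> parcs G"
    using pair_no_loops by fastforce
  define g where "g y = (a y \<odot>\<^bsub>W\<^esub> theta_basis R G f x y) v" for y
  have gx: "g x = (if (v, x) \<in> parcs G then a x \<otimes> f (v, x) else \<zero>)"
    using v ac x by (simp add: g_def free_module_def) (simp add: theta_basis_self_coord [unfolded free_module_def])
  have gy: "g y = (if v = y then a y else \<zero>)" if "y \<in> V" "y \<noteq> x" for y
    using that v ac by (simp add: g_def free_module_def theta_basis_def basis_vec_def)
  have gc: "g \<in> V \<rightarrow> carrier R"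
  proof (rule Pi_I)
    fix y assume "y \<in> V"
    then show "g y \<in> carrier R"
      using gx gy [of y] ac x by (cases "y = x") (auto simp: f_closed)
  qed
  have fin: "finite (V - {x})"
    using pair_finite_verts by simp
  have "theta R G f x a v = (\<Oplus> y \<in> V. g y)"
    unfolding theta_def g_def using a v pair_finite_verts ac
    by (simp add: finsum_coord theta_basis_closed)
  also have "\<dots> = (\<Oplus> y \<in> insert x (V - {x}). g y)"
    using x by (simp add: insert_absorb)
  also have "\<dots> = g x \<oplus> (\<Oplus> y \<in> V - {x}. g y)"
    using fin gc x by (intro R.finsum_insert) auto
  also have "(\<Oplus> y \<in> V - {x}. g y) = (\<Oplus> y \<in> V - {x}. if v = y then a y else \<zero>)"
    using gy ac by (intro R.finsum_cong') auto
  also have "\<dots> = (if v = x then \<zero> else a v)"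
  proof (cases "v = x")
    case True
    then have "(\<Oplus> y \<in> V - {x}. if v = y then a y else \<zero>) = (\<Oplus> y \<in> V - {x}. \<zero>)"
      by (intro R.finsum_cong') auto
    with True show ?thesis by simp
  next
    case False
    then show ?thesis
      using R.finsum_singleton [OF _ fin, of v a] v ac by auto
  qed
  finally show ?thesis
    using gx ac v x nl by (auto simp: R.a_comm f_closed)
qed

lemma W_eqI:
  "a \<in> carrier W \<Longrightarrow> b \<in> carrier W \<Longrightarrow> (\<And>v. v \<in> V \<Longrightarrow> a v = b v) \<Longrightarrow> a = b"
  unfolding W_carrier by (rule PiE_ext)

lemma theta_self:
  assumes "x \<in> V"
  shows "theta R G f x (basis_vec R V x) =
    (\<Oplus>\<^bsub>W\<^esub> z \<in> {z \<in> V. (z, x) \<in> parcs G}. f (z, x) \<odot>\<^bsub>W\<^esub> basis_vec R V z)"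
proof -
  have "theta R G f x (basis_vec R V x) = theta_basis R G f x x"
  proof (rule W_eqI)
    fix v assume "v \<in> V"
    moreover have "(x, x) \<notin> parcs G"
      using pair_no_loops by fastforce
    ultimately show "theta R G f x (basis_vec R V x) v = theta_basis R G f x x v"
      using assms
      by (auto simp: theta_coord basis_closed theta_basis_self_coord f_closed)
        (auto simp: basis_vec_def f_closed)
  qed (simp_all add: theta_closed basis_closed theta_basis_closed)
  then show ?thesis
    by (simp add: theta_basis_def)
qed

lemma theta_other:
  assumes "x \<in> V" "y \<in> V" "y \<noteq> x"
  shows "theta R G f x (basis_vec R V y) = basis_vec R V y"
proof (rule W_eqI)
  fix v assume "v \<in> V"
  then show "theta R G f x (basis_vec R V y) v = basis_vec R V y v"
    using assms
    by (auto simp: theta_coord basis_closed) (auto simp: basis_vec_def f_closed)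
qed (simp_all add: theta_closed basis_closed)

lemma theta_End:
  assumes x: "x \<in> V"
  shows "theta R G f x \<in> carrier EndW"
proof -
  have 1: "theta R G f x (a \<oplus>\<^bsub>W\<^esub> b) = theta R G f x a \<oplus>\<^bsub>W\<^esub> theta R G f x b"
    if a: "a \<in> carrier W" and b: "b \<in> carrier W" for a b
  proof (rule W_eqI)
    have add: "(c \<oplus>\<^bsub>W\<^esub> d) v = c v \<oplus> d v" if "v \<in> V" for c d v
      using that by (simp add: free_module_def)
    fix v assume v: "v \<in> V"
    show "theta R G f x (a \<oplus>\<^bsub>W\<^esub> b) v = (theta R G f x a \<oplus>\<^bsub>W\<^esub> theta R G f x b) v"
      using a b x v W_coord_closed [OF a] W_coord_closed [OF b]
      by (auto simp: add theta_coord f_closed R.l_distr R.a_ac)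
  qed (use a b in \<open>simp_all add: theta_closed\<close>)
  have 2: "theta R G f x (c \<odot>\<^bsub>W\<^esub> a) = c \<odot>\<^bsub>W\<^esub> theta R G f x a"
    if c: "c \<in> carrier R" and a: "a \<in> carrier W" for c a
  proof (rule W_eqI)
    have smult: "(c \<odot>\<^bsub>W\<^esub> d) v = c \<otimes> d v" if "v \<in> V" for d v
      using that by (simp add: free_module_def)
    fix v assume v: "v \<in> V"
    show "theta R G f x (c \<odot>\<^bsub>W\<^esub> a) v = (c \<odot>\<^bsub>W\<^esub> theta R G f x a) v"
      using a c x v W_coord_closed [OF a]
      by (auto simp: smult theta_coord f_closed R.r_distr R.m_assoc)
  qed (use a c in \<open>simp_all add: theta_closed\<close>)
  have "theta R G f x \<in> carrier W \<rightarrow>\<^sub>E carrier W"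
    by (rule PiE_I) (simp_all add: theta_closed, simp add: theta_def)
  with 1 2 show ?thesis
    by (simp add: End_monoid_def)
qed

interpretation E: monoid EndW
  by (rule monoid_End_monoid) (rule module_free_module, rule R.is_cring)

lemma word_rep_Nil: "word_rep R G f [] = \<one>\<^bsub>EndW\<^esub>"
  and word_rep_Cons: "word_rep R G f (x # w) = theta R G f x \<otimes>\<^bsub>EndW\<^esub> word_rep R G f w"
  by (simp_all add: word_rep_def)

lemma word_rep_closed: "w \<in> lists V \<Longrightarrow> word_rep R G f w \<in> carrier EndW"
  by (induction w) (auto simp: word_rep_Nil word_rep_Cons theta_End)

lemma word_rep_append:
  "u \<in> lists V \<Longrightarrow> w \<in> lists V \<Longrightarrow>
    word_rep R G f (u @ w) = word_rep R G f u \<otimes>\<^bsub>EndW\<^esub> word_rep R G f w"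
  by (induction u)
    (auto simp: word_rep_Nil word_rep_Cons theta_End word_rep_closed E.m_assoc)

lemma End_eqI:
  "\<phi> \<in> carrier EndW \<Longrightarrow> \<psi> \<in> carrier EndW \<Longrightarrow>
    (\<And>a v. a \<in> carrier W \<Longrightarrow> v \<in> V \<Longrightarrow> \<phi> a v = \<psi> a v) \<Longrightarrow> \<phi> = \<psi>"
  by (rule PiE_ext [of _ "carrier W" "\<lambda>_. carrier W"])
    (auto simp: End_monoid_def intro!: W_eqI)

lemma End_mult_apply: "a \<in> carrier W \<Longrightarrow> (\<phi> \<otimes>\<^bsub>EndW\<^esub> \<psi>) a = \<phi> (\<psi> a)"
  by (simp add: End_monoid_def compose_def)

lemma word_rep_apply:
  assumes "a \<in> carrier W"
  shows "word_rep R G f [] a = a"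
    and "word_rep R G f (x # w) a = theta R G f x (word_rep R G f w a)"
  using assms by (simp_all add: word_rep_Nil word_rep_Cons End_mult_apply)
    (simp add: End_monoid_def)

lemma word_rep_cong:
  "(u, w) \<in> HK_cong G \<Longrightarrow> word_rep R G f u = word_rep R G f w"
proof (induction rule: HK_cong.induct)
  case (append u u' v v')
  then show ?case
    using HK_cong_words [OF append.hyps(1)] HK_cong_words [OF append.hyps(2)]
    by (simp add: word_rep_append)
next
  case (idem x)
  have "(x, x) \<notin> parcs G"
    using pair_no_loops by fastforce
  with idem show ?case
    by (intro End_eqI word_rep_closed)
      (auto simp: word_rep_apply theta_coord theta_closed W_coord_closed f_closed)
next
  case (comm x y)
  then show ?case
    by (intro End_eqI word_rep_closed)
      (auto simp: word_rep_apply theta_coord theta_closed W_coord_closed f_closed R.a_ac)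
next
  case (arc_left x y)
  have "(y, x) \<notin> parcs G" "x \<noteq> y" "(x, x) \<notin> parcs G" "(y, y) \<notin> parcs G"
    using one_arc pair_no_loops arc_left by fastforce+
  with arc_left show ?case
    by (intro End_eqI word_rep_closed)
      (auto simp: word_rep_apply theta_coord theta_closed W_coord_closed f_closed R.a_ac R.l_distr)
next
  case (arc_right x y)
  have "(y, x) \<notin> parcs G" "x \<noteq> y" "(x, x) \<notin> parcs G" "(y, y) \<notin> parcs G"
    using one_arc pair_no_loops arc_right by fastforce+
  with arc_right show ?case
    by (intro End_eqI word_rep_closed)
      (auto simp: word_rep_apply theta_coord theta_closed W_coord_closed f_closed R.a_ac R.l_distr)
qed auto

lemma HK_rep_class:
  assumes "w \<in> lists V"
  shows "HK_rep R G f (HK_class G w) = word_rep R G f w"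
proof -
  have "w \<in> HK_class G w"
    using assms by (auto simp: HK_class_def intro: HK_cong.refl)
  moreover have "word_rep R G f u = word_rep R G f w" if "u \<in> HK_class G w" for u
    using that by (auto simp: HK_class_def dest: word_rep_cong)
  ultimately have "word_rep R G f ` HK_class G w = {word_rep R G f w}"
    by blast
  then show ?thesis
    by (simp add: HK_rep_def)
qed

lemma HK_rep_one: "HK_rep R G f \<one>\<^bsub>HK G\<^esub> = \<one>\<^bsub>EndW\<^esub>"
  using HK_rep_class [of "[]"] by (simp add: HK_def word_rep_Nil)

lemma HK_rep_vertex: "x \<in> V \<Longrightarrow> HK_rep R G f (HK_class G [x]) = theta R G f x"
  using HK_rep_class [of "[x]"] by (simp add: word_rep_Nil word_rep_Cons theta_End)

lemma HK_rep_hom: "HK_rep R G f \<in> hom (HK G) EndW"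
proof (rule homI)
  fix A B assume "A \<in> carrier (HK G)" "B \<in> carrier (HK G)"
  then obtain u w where u: "u \<in> lists V" "A = HK_class G u"
    and w: "w \<in> lists V" "B = HK_class G w"
    unfolding carrier_HK by blast
  moreover have "u @ w \<in> lists V"
    using u w by auto
  ultimately show "HK_rep R G f (A \<otimes>\<^bsub>HK G\<^esub> B) =
      HK_rep R G f A \<otimes>\<^bsub>EndW\<^esub> HK_rep R G f B"
    by (simp add: HK_mult_class HK_rep_class word_rep_append)
qed (unfold carrier_HK, elim imageE, simp add: HK_rep_class word_rep_closed)

end

lemma (in domain) HK_weighted_one: "type_A n G \<Longrightarrow> HK_weighted G R (\<lambda>_. \<one>)"
  by (intro HK_weighted.intro HK_weighted_axioms.intro type_A_simple_digraph is_cring)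
    (simp_all add: weight_function_def)

end

theory Submission
  imports Defs "HOL-Library.Sublist"
begin

text \<open>
  The invariant of a word \<open>w\<close> is the set of directed paths, read as words, that are subsequences
  of \<open>w\<close>. The operator of a word moves a basis vector backwards along arcs, so the coefficient
  at \<open>x\<close> of the image of \<open>y\<close> is one exactly if the directed path \<open>p\<close> from \<open>x\<close> to \<open>y\<close> (which is
  unique) is not a subsequence of \<open>w\<close> but its tail is. Hence the operator determines the invariant.

  The invariant in turn determines the class of \<open>w\<close>. For a linearly oriented chain
  \<open>c\<^sub>0 \<rightarrow> \<dots> \<rightarrow> c\<^sub>l\<close>, a word containing \<open>c\<^sub>l\<close> is congruent to \<open>c\<^sub>k \<dots> c\<^sub>l\<close> followed by the word with
  \<open>c\<^sub>l\<close> erased, and \<open>k\<close> is read off the invariant, so induction on \<open>l\<close> applies. At an inner sink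
  or source \<open>s\<close> a word can be rewritten to contain \<open>s\<close> at most once; the letters on the two sides
  of \<open>s\<close> commute, so the two sides can be normalised independently.
\<close>

section \<open>Directed paths as words and the subsequence invariant\<close>

definition dpath :: "'v pair_pre_digraph \<Rightarrow> 'v list \<Rightarrow> bool" where
  "dpath G p \<longleftrightarrow> set p \<subseteq> pverts G \<and> successively (\<lambda>x y. (x, y) \<in> parcs G) p"

lemma dpath_Nil [simp]: "dpath G []"
  by (simp add: dpath_def)

lemma dpath_singleton [simp]: "dpath G [x] \<longleftrightarrow> x \<in> pverts G"
  by (simp add: dpath_def)

lemma dpath_Cons_Cons [simp]:
  "dpath G (x # y # p) \<longleftrightarrow> x \<in> pverts G \<and> (x, y) \<in> parcs G \<and> dpath G (y # p)"
  by (auto simp: dpath_def)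

lemma dpath_ConsD: "dpath G (x # p) \<Longrightarrow> dpath G p"
  by (cases p) auto

lemma dpath_appendD: "dpath G (p @ q) \<Longrightarrow> dpath G p \<and> dpath G q"
  by (auto simp: dpath_def successively_append_iff)

definition same_dpaths :: "'v pair_pre_digraph \<Rightarrow> 'v list \<Rightarrow> 'v list \<Rightarrow> bool" where
  "same_dpaths G u w \<longleftrightarrow> (\<forall>p. dpath G p \<longrightarrow> subseq p u = subseq p w)"

lemma same_dpaths_sym: "same_dpaths G u w \<Longrightarrow> same_dpaths G w u"
  by (simp add: same_dpaths_def)

lemma same_dpaths_trans: "same_dpaths G u v \<Longrightarrow> same_dpaths G v w \<Longrightarrow> same_dpaths G u w"
  by (simp add: same_dpaths_def)

text \<open>A subsequence of \<open>u @ v\<close> splits into one of \<open>u\<close> followed by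
  one of \<open>v\<close>, and the two pieces of a path are again paths.\<close>

lemma same_dpaths_append:
  assumes "same_dpaths G u u'" "same_dpaths G v v'"
  shows "same_dpaths G (u @ v) (u' @ v')"
  using assms unfolding same_dpaths_def subseq_append_iff
  by (metis dpath_appendD)

lemma subseq_singleton_right [simp]: "subseq p [x] \<longleftrightarrow> p = [] \<or> p = [x]"
  by (cases p) (auto split: if_splits)

lemma subseq_set: "subseq p w \<Longrightarrow> set p \<subseteq> set w"
  by (auto elim: list_emb_set)

lemma subseq_filter_iff: "subseq p (filter Q w) \<longleftrightarrow> (\<forall>x\<in>set p. Q x) \<and> subseq p w"
proof (induction w arbitrary: p)
  case (Cons x w)
  then show ?case
    by (cases p) (auto split: if_splits)
qed (auto dest: list_emb_Nil2)

text \<open>Lets the inductions below pass to words over fewer letters without losing the hypothesis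
  on the invariant.\<close>

lemma same_dpaths_filter: "same_dpaths G u w \<Longrightarrow> same_dpaths G (filter Q u) (filter Q w)"
  by (simp add: same_dpaths_def subseq_filter_iff)

lemma same_dpaths_mem:
  assumes "same_dpaths G u w" "x \<in> pverts G"
  shows "x \<in> set u \<longleftrightarrow> x \<in> set w"
  using assms unfolding same_dpaths_def by (metis dpath_singleton subseq_singleton_left)

section \<open>Invariance under the defining relations\<close>

context simple_digraph
begin

declare HK_cong.trans [trans]

lemma arcD: "(x, y) \<in> parcs G \<Longrightarrow> x \<noteq> y \<and> x \<in> pverts G \<and> y \<in> pverts G \<and> (y, x) \<notin> parcs G"
  using one_arc [of x y] pair_no_loops in_arcsD1 in_arcsD2 by fastforce

text \<open>A subsequence that only one side of a relation has contains a repeated letter, a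
  reversed arc or a non-adjacent pair side by side, so it is not a path.\<close>

lemma same_dpaths_HK_cong: "(u, w) \<in> HK_cong G \<Longrightarrow> same_dpaths G u w"
proof (induction rule: HK_cong.induct)
  case (append u u' v v')
  then show ?case by (simp add: same_dpaths_append)
next
  case (arc_left x y)
  note * = arcD [OF arc_left(3)] arcD [of x x] arcD [of y y]
  show ?case unfolding same_dpaths_def
  proof (intro allI impI)
    fix p assume "dpath G p"
    \<comment> \<open>The rule \<open>remdups_adj.cases\<close> merely distinguishes words with no
      letter, one letter and at least two letters.\<close>
    with * show "subseq p [x, y, x] = subseq p [x, y]"
      by (cases p rule: remdups_adj.cases) (auto split: if_splits)
  qed
next
  case (arc_right x y)
  note * = arcD [OF arc_right(3)] arcD [of x x] arcD [of y y]
  show ?case unfolding same_dpaths_def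
  proof (intro allI impI)
    fix p assume "dpath G p"
    with * show "subseq p [y, x, y] = subseq p [x, y]"
      by (cases p rule: remdups_adj.cases) (auto split: if_splits)
  qed
next
  case (idem x)
  have *: "(x, x) \<notin> parcs G" using arcD by blast
  show ?case unfolding same_dpaths_def
  proof (intro allI impI)
    fix p assume "dpath G p"
    with * show "subseq p [x, x] = subseq p [x]"
      by (cases p rule: remdups_adj.cases) (auto split: if_splits)
  qed
next
  case (comm x y)
  show ?case unfolding same_dpaths_def
  proof (intro allI impI)
    fix p assume "dpath G p"
    with comm show "subseq p [x, y] = subseq p [y, x]"
      by (cases p rule: remdups_adj.cases) (auto split: if_splits)
  qed
qed (auto simp: same_dpaths_def)


section \<open>Commutation and absorption of letters\<close>

lemma HK_refl: "set u \<subseteq> pverts G \<Longrightarrow> (u, u) \<in> HK_cong G"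
  by (intro HK_cong.refl) auto

lemma HK_context:
  "(u, w) \<in> HK_cong G \<Longrightarrow> set p \<subseteq> pverts G \<Longrightarrow> set q \<subseteq> pverts G \<Longrightarrow>
    (p @ u @ q, p @ w @ q) \<in> HK_cong G"
  by (intro HK_cong.append HK_refl)

lemma HK_prefix:
  "(u, w) \<in> HK_cong G \<Longrightarrow> set p \<subseteq> pverts G \<Longrightarrow> (p @ u, p @ w) \<in> HK_cong G"
  by (intro HK_cong.append HK_refl)

lemma HK_suffix:
  "(u, w) \<in> HK_cong G \<Longrightarrow> set q \<subseteq> pverts G \<Longrightarrow> (u @ q, w @ q) \<in> HK_cong G"
  by (intro HK_cong.append HK_refl)

lemma HK_Cons: "(u, w) \<in> HK_cong G \<Longrightarrow> x \<in> pverts G \<Longrightarrow> (x # u, x # w) \<in> HK_cong G"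
  using HK_prefix [of u w "[x]"] by simp

lemma HK_comm_letter:
  assumes "x \<in> pverts G" "set u \<subseteq> pverts G"
    and "\<And>y. y \<in> set u \<Longrightarrow> (x, y) \<notin> parcs G \<and> (y, x) \<notin> parcs G"
  shows "(x # u, u @ [x]) \<in> HK_cong G"
  using assms(2,3)
proof (induction u)
  case Nil
  then show ?case using assms(1) by (simp add: HK_refl)
next
  case (Cons y u)
  have "([x, y], [y, x]) \<in> HK_cong G"
    using Cons.prems assms(1) by (intro HK_cong.comm) auto
  then have "([x, y] @ u, [y, x] @ u) \<in> HK_cong G"
    by (rule HK_suffix) (use Cons.prems in auto)
  moreover have "(y # x # u, y # u @ [x]) \<in> HK_cong G"
    using Cons by (intro HK_Cons) auto
  ultimately show ?case
    using HK_cong.trans by fastforce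
qed

lemma HK_comm_words:
  assumes "set u \<subseteq> pverts G" "set w \<subseteq> pverts G"
    and "\<And>x y. x \<in> set u \<Longrightarrow> y \<in> set w \<Longrightarrow> (x, y) \<notin> parcs G \<and> (y, x) \<notin> parcs G"
  shows "(u @ w, w @ u) \<in> HK_cong G"
  using assms(1,3)
proof (induction u)
  case Nil
  then show ?case using assms(2) by (simp add: HK_refl)
next
  case (Cons x u)
  have "(x # u @ w, x # w @ u) \<in> HK_cong G"
    using Cons by (intro HK_Cons) auto
  moreover have "((x # w) @ u, (w @ [x]) @ u) \<in> HK_cong G"
    using Cons.prems assms(2) by (intro HK_suffix HK_comm_letter) auto
  ultimately show ?case
    using HK_cong.trans by fastforce
qed

lemma HK_split_filter:
  assumes "set u \<subseteq> pverts G"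
    and "\<And>x y. x \<in> set u \<Longrightarrow> y \<in> set u \<Longrightarrow> Q x \<Longrightarrow> \<not> Q y \<Longrightarrow> (x, y) \<notin> parcs G \<and> (y, x) \<notin> parcs G"
  shows "(u, filter Q u @ filter (\<lambda>x. \<not> Q x) u) \<in> HK_cong G"
  using assms
proof (induction u)
  case Nil
  then show ?case by (simp add: HK_refl)
next
  case (Cons x u)
  let ?f = "filter Q u" and ?g = "filter (\<lambda>x. \<not> Q x) u"
  have *: "(x # u, x # ?f @ ?g) \<in> HK_cong G"
    using Cons by (intro HK_Cons) auto
  show ?case
  proof (cases "Q x")
    case True
    with * show ?thesis by simp
  next
    case False
    have "((x # ?f) @ ?g, (?f @ [x]) @ ?g) \<in> HK_cong G"
      using Cons.prems False by (intro HK_suffix HK_comm_letter) auto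
    with * False show ?thesis
      using HK_cong.trans by fastforce
  qed
qed

text \<open>The leading \<open>s\<close> moves right through \<open>u\<close>. It commutes with its
  right neighbour \<open>y\<close> unless there is an arc from \<open>y\<close> to \<open>s\<close>.
  In that case a copy of \<open>s\<close> is first created behind \<open>y\<close>, and then
  \<open>s y s\<close> collapses to \<open>y s\<close>.\<close>

lemma HK_absorb_left:
  assumes s: "s \<in> pverts G" and "set u \<subseteq> pverts G" "\<And>y. y \<in> set u \<Longrightarrow> (s, y) \<notin> parcs G"
  shows "(s # u @ [s], u @ [s]) \<in> HK_cong G"
  using assms(2,3)
proof (induction u)
  case Nil
  then show ?case using HK_cong.idem [OF s] by simp
next
  case (Cons y u)
  have y: "y \<in> pverts G" and u: "set (u @ [s]) \<subseteq> pverts G"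
    using Cons.prems s by auto
  have IH: "(s # u @ [s], u @ [s]) \<in> HK_cong G"
    using Cons by auto
  show ?case
  proof (cases "(y, s) \<in> parcs G")
    case True
    have "([s, y] @ u @ [s], [s, y] @ s # u @ [s]) \<in> HK_cong G"
      using IH s y by (intro HK_prefix) (auto intro: HK_cong.sym)
    also have "([s, y] @ s # u @ [s], [y, s] @ u @ [s]) \<in> HK_cong G"
      using HK_suffix [OF HK_cong.arc_right [OF y s True] u] by simp
    also have "([y, s] @ u @ [s], [y] @ u @ [s]) \<in> HK_cong G"
      using HK_Cons [OF IH y] by simp
    finally show ?thesis by simp
  next
    case False
    have "([s, y] @ u @ [s], [y, s] @ u @ [s]) \<in> HK_cong G"
      using False Cons.prems s y u by (intro HK_suffix HK_cong.comm) auto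
    also have "([y, s] @ u @ [s], [y] @ u @ [s]) \<in> HK_cong G"
      using HK_Cons [OF IH y] by simp
    finally show ?thesis by simp
  qed
qed

text \<open>Mirror image of \<open>HK_absorb_left\<close>: the final \<open>s\<close> moves left,
  and \<open>s y s\<close> collapses to \<open>s y\<close>.\<close>

lemma HK_absorb_right:
  assumes s: "s \<in> pverts G" and "set u \<subseteq> pverts G" "\<And>y. y \<in> set u \<Longrightarrow> (y, s) \<notin> parcs G"
  shows "(s # u @ [s], s # u) \<in> HK_cong G"
  using assms(2,3)
proof (induction u rule: rev_induct)
  case Nil
  then show ?case using HK_cong.idem [OF s] by simp
next
  case (snoc y u)
  have y: "y \<in> pverts G" and u: "set (s # u) \<subseteq> pverts G"
    using snoc.prems s by auto
  have IH: "(s # u @ [s], s # u) \<in> HK_cong G"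
    using snoc by auto
  show ?case
  proof (cases "(s, y) \<in> parcs G")
    case True
    have "((s # u) @ [y, s], (s # u @ [s]) @ [y, s]) \<in> HK_cong G"
      using IH s y by (intro HK_suffix) (auto intro: HK_cong.sym)
    also have "((s # u @ [s]) @ [y, s], (s # u) @ [s, y]) \<in> HK_cong G"
      using HK_prefix [OF HK_cong.arc_left [OF s y True] u] by simp
    also have "((s # u) @ [s, y], (s # u) @ [y]) \<in> HK_cong G"
      using HK_suffix [OF IH, of "[y]"] y by simp
    finally show ?thesis by simp
  next
    case False
    have "((s # u) @ [y, s], (s # u) @ [s, y]) \<in> HK_cong G"
      using False snoc.prems s y u by (intro HK_prefix HK_cong.comm) auto
    also have "((s # u) @ [s, y], (s # u) @ [y]) \<in> HK_cong G"
      using HK_suffix [OF IH, of "[y]"] y by simp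
    finally show ?thesis by simp
  qed
qed

lemma HK_remove_before:
  assumes s: "s \<in> pverts G" and "set u \<subseteq> pverts G" "\<And>y. y \<in> set u \<Longrightarrow> (s, y) \<notin> parcs G"
  shows "(u @ [s], filter (\<lambda>y. y \<noteq> s) u @ [s]) \<in> HK_cong G"
  using assms(2,3)
proof (induction u)
  case Nil
  then show ?case using s by (simp add: HK_refl)
next
  case (Cons y u)
  have IH: "(u @ [s], filter (\<lambda>y. y \<noteq> s) u @ [s]) \<in> HK_cong G"
    using Cons by auto
  show ?case
  proof (cases "y = s")
    case True
    have "(s # u @ [s], u @ [s]) \<in> HK_cong G"
      using Cons.prems s by (intro HK_absorb_left) auto
    with IH True show ?thesis
      using HK_cong.trans by fastforce
  next
    case False
    with IH Cons.prems show ?thesis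
      by (auto intro: HK_Cons)
  qed
qed

lemma HK_remove_after:
  assumes s: "s \<in> pverts G" and "set u \<subseteq> pverts G" "\<And>y. y \<in> set u \<Longrightarrow> (y, s) \<notin> parcs G"
  shows "(s # u, s # filter (\<lambda>y. y \<noteq> s) u) \<in> HK_cong G"
  using assms(2,3)
proof (induction u rule: rev_induct)
  case Nil
  then show ?case using s by (simp add: HK_refl)
next
  case (snoc y u)
  have IH: "(s # u, s # filter (\<lambda>y. y \<noteq> s) u) \<in> HK_cong G"
    using snoc by auto
  show ?case
  proof (cases "y = s")
    case True
    have "(s # u @ [s], s # u) \<in> HK_cong G"
      using snoc.prems s by (intro HK_absorb_right) auto
    with IH True show ?thesis
      using HK_cong.trans by fastforce
  next
    case False
    with HK_suffix [OF IH, of "[y]"] snoc.prems show ?thesis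
      by auto
  qed
qed

text \<open>If \<open>s\<close> is a sink among the letters of \<open>w\<close>, its last occurrence
  absorbs the earlier ones; if it is a source, its first occurrence absorbs the later ones.\<close>

lemma HK_single_occurrence:
  assumes w: "set w \<subseteq> pverts G" "s \<in> set w"
    and s: "(\<forall>y\<in>set w. (s, y) \<notin> parcs G) \<or> (\<forall>y\<in>set w. (y, s) \<notin> parcs G)"
  obtains u v where "(w, u @ [s] @ v) \<in> HK_cong G" "set u \<subseteq> set w - {s}" "set v \<subseteq> set w - {s}"
  using s
proof
  assume s: "\<forall>y\<in>set w. (s, y) \<notin> parcs G"
  obtain u v where uv: "w = u @ s # v" "s \<notin> set v"
    using w(2) by (meson split_list_last)
  have "((u @ [s]) @ v, (filter (\<lambda>y. y \<noteq> s) u @ [s]) @ v) \<in> HK_cong G"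
    using w s uv by (intro HK_suffix HK_remove_before) auto
  with uv show thesis
    by (intro that [of "filter (\<lambda>y. y \<noteq> s) u" v]) auto
next
  assume s: "\<forall>y\<in>set w. (y, s) \<notin> parcs G"
  obtain u v where uv: "w = u @ s # v" "s \<notin> set u"
    using w(2) by (meson split_list_first)
  have "(u @ s # v, u @ s # filter (\<lambda>y. y \<noteq> s) v) \<in> HK_cong G"
    using w s uv by (intro HK_prefix HK_remove_after) auto
  with uv show thesis
    by (intro that [of u "filter (\<lambda>y. y \<noteq> s) v"]) auto
qed

section \<open>Gluing two vertex sets at a sink or source\<close>

text \<open>The converse of \<open>same_dpaths_HK_cong\<close> for words over \<open>S\<close>.
  Paths that leave \<open>S\<close> are not subsequences of such words, so only paths inside
  \<open>S\<close> matter.\<close>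

definition dpath_determined :: "'v set \<Rightarrow> bool" where
  "dpath_determined S \<longleftrightarrow>
    (\<forall>u w. set u \<subseteq> S \<longrightarrow> set w \<subseteq> S \<longrightarrow> same_dpaths G u w \<longrightarrow> (u, w) \<in> HK_cong G)"

lemma dpath_determinedD:
  "dpath_determined S \<Longrightarrow> set u \<subseteq> S \<Longrightarrow> set w \<subseteq> S \<Longrightarrow> same_dpaths G u w \<Longrightarrow> (u, w) \<in> HK_cong G"
  by (simp add: dpath_determined_def)

text \<open>With a single \<open>s\<close> left, the letters of \<open>S\<close> and those of
  \<open>T\<close> on either side of it commute. Either kind can therefore be gathered around
  \<open>s\<close> into a contiguous word over \<open>S\<close> or over \<open>T\<close>, to which
  the corresponding hypothesis applies.\<close>

lemma dpath_determined_glue: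
  assumes V: "S \<subseteq> pverts G" "T \<subseteq> pverts G" and ST: "S \<inter> T = {s}"
    and nonadj: "\<And>x y. x \<in> S - {s} \<Longrightarrow> y \<in> T - {s} \<Longrightarrow> (x, y) \<notin> parcs G \<and> (y, x) \<notin> parcs G"
    and s: "(\<forall>y\<in>S \<union> T. (s, y) \<notin> parcs G) \<or> (\<forall>y\<in>S \<union> T. (y, s) \<notin> parcs G)"
    and S: "dpath_determined S" and T: "dpath_determined T"
  shows "dpath_determined (S \<union> T)"
  unfolding dpath_determined_def
proof (intro allI impI)
  fix w w' assume w: "set w \<subseteq> S \<union> T" "set w' \<subseteq> S \<union> T" and same: "same_dpaths G w w'"
  let ?S = "filter (\<lambda>x. x \<in> S)" and ?T = "filter (\<lambda>x. x \<in> T)"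
  have sV: "s \<in> pverts G" and sST: "s \<in> S" "s \<in> T"
    using V ST by auto
  have comm: "(?S u @ ?T v, ?T v @ ?S u) \<in> HK_cong G" if "s \<notin> set u" "s \<notin> set v" for u v
    using V nonadj that by (intro HK_comm_words) fastforce+
  have split: "(u, ?S u @ ?T u) \<in> HK_cong G" if u: "set u \<subseteq> S \<union> T - {s}" for u
  proof -
    have "?T u = filter (\<lambda>x. x \<notin> S) u"
      using u ST by (intro filter_cong) auto
    moreover have "(u, ?S u @ filter (\<lambda>x. x \<notin> S) u) \<in> HK_cong G"
    proof (rule HK_split_filter)
      fix x y assume "x \<in> set u" "y \<in> set u" "x \<in> S" "y \<notin> S"
      then show "(x, y) \<notin> parcs G \<and> (y, x) \<notin> parcs G"
        using u nonadj [of x y] by blast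
    qed (use u V in auto)
    ultimately show ?thesis by simp
  qed
  have split': "(u, ?T u @ ?S u) \<in> HK_cong G" if u: "set u \<subseteq> S \<union> T - {s}" for u
    using split [OF u] comm [of u u] u HK_cong.trans by blast
  have S_filter: "(?S u, ?S u') \<in> HK_cong G" and T_filter: "(?T u, ?T u') \<in> HK_cong G"
    if "same_dpaths G u u'" for u u'
    using that by (intro dpath_determinedD [OF S] dpath_determinedD [OF T] same_dpaths_filter; auto)+
  have filters: "set (?S u) \<subseteq> pverts G" "set (?T u) \<subseteq> pverts G" for u
    using V by auto
  show "(w, w') \<in> HK_cong G"
  proof (cases "s \<in> set w")
    \<comment> \<open>Without \<open>s\<close> the word falls apart into an \<open>S\<close>-part
      and a \<open>T\<close>-part that commute.\<close>
    case False
    then have "s \<notin> set w'"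
      using same_dpaths_mem [OF same sV] by simp
    then have w': "set w' \<subseteq> S \<union> T - {s}"
      using w by auto
    have "(w, ?S w @ ?T w) \<in> HK_cong G"
      using False w by (intro split) auto
    also have "(?S w @ ?T w, ?S w' @ ?T w') \<in> HK_cong G"
      using same by (intro HK_cong.append S_filter T_filter)
    also have "(?S w' @ ?T w', w') \<in> HK_cong G"
      using split [OF w'] by (rule HK_cong.sym)
    finally show ?thesis .
  next
    case True
    then have True': "s \<in> set w'"
      using same_dpaths_mem [OF same sV] by simp
    obtain u v where uv: "(w, u @ [s] @ v) \<in> HK_cong G"
      "set u \<subseteq> set w - {s}" "set v \<subseteq> set w - {s}"
      by (rule HK_single_occurrence [of w s]) (use True w V s in blast)+
    obtain u' v' where uv': "(w', u' @ [s] @ v') \<in> HK_cong G"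
      "set u' \<subseteq> set w' - {s}" "set v' \<subseteq> set w' - {s}"
      by (rule HK_single_occurrence [of w' s]) (use True' w V s in blast)+
    have same': "same_dpaths G (u @ [s] @ v) (u' @ [s] @ v')"
      using same_dpaths_HK_cong [OF uv(1)] same_dpaths_HK_cong [OF uv'(1)] same
      by (meson same_dpaths_sym same_dpaths_trans)
    have sets: "set u \<subseteq> S \<union> T - {s}" "set v \<subseteq> S \<union> T - {s}"
      "set u' \<subseteq> S \<union> T - {s}" "set v' \<subseteq> S \<union> T - {s}"
      using uv uv' w by auto
    have nots: "s \<notin> set u" "s \<notin> set v" "s \<notin> set u'" "s \<notin> set v'"
      using sets by auto
    \<comment> \<open>First the \<open>S\<close>-letters are gathered around \<open>s\<close>, with
      the \<open>T\<close>-letters outside, and the \<open>S\<close>-part is exchanged for that of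
      \<open>w'\<close>. Then the two kinds swap places and the \<open>T\<close>-part is
      exchanged.\<close>
    note uv(1)
    also have "(u @ [s] @ v, (?T u @ ?S u) @ [s] @ (?S v @ ?T v)) \<in> HK_cong G"
      using sV by (intro HK_cong.append split split' sets HK_refl) auto
    also have "(?T u @ ?S u) @ [s] @ (?S v @ ?T v) = ?T u @ ?S (u @ [s] @ v) @ ?T v"
      using sST by simp
    also have "(?T u @ ?S (u @ [s] @ v) @ ?T v, ?T u @ ?S (u' @ [s] @ v') @ ?T v) \<in> HK_cong G"
      by (intro HK_context S_filter same' filters)
    also have "?T u @ ?S (u' @ [s] @ v') @ ?T v = (?T u @ ?S u') @ [s] @ (?S v' @ ?T v)"
      using sST by simp
    also have "((?T u @ ?S u') @ [s] @ (?S v' @ ?T v), (?S u' @ ?T u) @ [s] @ (?T v @ ?S v')) \<in> HK_cong G"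
      using sV nots by (intro HK_cong.append comm HK_refl HK_cong.sym [OF comm]) auto
    also have "(?S u' @ ?T u) @ [s] @ (?T v @ ?S v') = ?S u' @ ?T (u @ [s] @ v) @ ?S v'"
      using sST by simp
    also have "(?S u' @ ?T (u @ [s] @ v) @ ?S v', ?S u' @ ?T (u' @ [s] @ v') @ ?S v') \<in> HK_cong G"
      by (intro HK_context T_filter same' filters)
    also have "?S u' @ ?T (u' @ [s] @ v') @ ?S v' = (?S u' @ ?T u') @ [s] @ (?T v' @ ?S v')"
      using sST by simp
    also have "(\<dots>, u' @ [s] @ v') \<in> HK_cong G"
      using sV by (intro HK_cong.append HK_cong.sym [OF split] HK_cong.sym [OF split'] sets HK_refl) auto
    also note HK_cong.sym [OF uv'(1)]
    finally show ?thesis .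
  qed
qed


section \<open>Linearly oriented chains\<close>

context
  fixes c :: "nat \<Rightarrow> 'v" and m :: nat
  assumes inj: "inj_on c {..<m}" and c_verts: "c ` {..<m} \<subseteq> pverts G"
    and arcs: "\<And>i j. i < m \<Longrightarrow> j < m \<Longrightarrow> (c i, c j) \<in> parcs G \<longleftrightarrow> j = Suc i"
  notes upt_Suc [simp del]
begin

lemma c_eq_iff: "i < m \<Longrightarrow> j < m \<Longrightarrow> c i = c j \<longleftrightarrow> i = j"
  using inj by (auto dest: inj_onD)

lemma c_mem: "i < m \<Longrightarrow> c i \<in> pverts G"
  using c_verts by auto

lemma dpath_chain: "l < m \<Longrightarrow> dpath G (map c [k..<Suc l])"
proof (induction l)
  case (Suc l)
  then show ?case
    using c_verts arcs
    by (auto simp: dpath_def successively_append_iff last_map upt_Suc)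
qed (auto simp: c_mem upt_Suc)

text \<open>The letters of the block before its own \<open>c i\<close> have smaller indices, so no
  arc leads from \<open>c i\<close> to them and \<open>HK_absorb_left\<close> applies.\<close>

lemma chain_absorb_left:
  assumes "k \<le> i" "i \<le> l" "l < m"
  shows "(c i # map c [k..<Suc l], map c [k..<Suc l]) \<in> HK_cong G"
proof -
  have "[k..<Suc l] = [k..<i] @ i # [Suc i..<Suc l]"
    using assms upt_add_eq_append [of k i "Suc l - i"] upt_conv_Cons [of i "Suc l"] by simp
  moreover have "((c i # map c [k..<i] @ [c i]) @ map c [Suc i..<Suc l],
      (map c [k..<i] @ [c i]) @ map c [Suc i..<Suc l]) \<in> HK_cong G"
    using assms c_verts arcs by (intro HK_suffix HK_absorb_left) auto
  ultimately show ?thesis by simp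
qed

text \<open>The letters of the block after its own \<open>c i\<close> have larger indices, so no arc
  leads from them to \<open>c i\<close>.\<close>

lemma chain_absorb_right:
  assumes "k \<le> i" "i \<le> l" "l < m"
  shows "(map c [k..<Suc l] @ [c i], map c [k..<Suc l]) \<in> HK_cong G"
proof -
  have "[k..<Suc l] = [k..<i] @ i # [Suc i..<Suc l]"
    using assms upt_add_eq_append [of k i "Suc l - i"] upt_conv_Cons [of i "Suc l"] by simp
  moreover have "(map c [k..<i] @ c i # map c [Suc i..<Suc l] @ [c i],
      map c [k..<i] @ c i # map c [Suc i..<Suc l]) \<in> HK_cong G"
    using assms c_verts arcs by (intro HK_prefix HK_absorb_right) auto
  ultimately show ?thesis by simp
qed

text \<open>Letters are prepended one at a time to the block \<open>c k, ..., c l\<close>. A new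
  letter is absorbed, extends the block by one on the left, or commutes past it, according to its
  index.\<close>

lemma chain_factor:
  assumes "l < m" "set w \<subseteq> c ` {..l}" "c l \<in> set w"
  shows "\<exists>k\<le>l. (w, map c [k..<Suc l] @ filter (\<lambda>x. x \<noteq> c l) w) \<in> HK_cong G"
  using assms(2,3)
proof (induction w)
  case (Cons y w)
  let ?f = "filter (\<lambda>x. x \<noteq> c l) w"
  have V: "set w \<subseteq> pverts G" "set ?f \<subseteq> pverts G"
    using Cons.prems c_mem assms(1) by fastforce+
  obtain i where i: "y = c i" "i \<le> l"
    using Cons.prems by auto
  have y: "y \<in> pverts G" and im: "i < m"
    using i assms(1) by (auto intro: c_mem)
  show ?case
  proof (cases "c l \<in> set w")
    case False
    then have "y = c l" "?f = w"
      using Cons.prems by (auto intro!: filter_True)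
    moreover have "(c l # w, c l # w) \<in> HK_cong G"
      using V c_mem [OF assms(1)] by (intro HK_refl) auto
    ultimately show ?thesis
      by (intro exI [of _ l]) (simp add: upt_conv_Cons)
  next
    case True
    then obtain k where k: "k \<le> l" and IH: "(w, map c [k..<Suc l] @ ?f) \<in> HK_cong G"
      using Cons by auto
    have step: "(y # w, (y # map c [k..<Suc l]) @ ?f) \<in> HK_cong G"
      using HK_Cons [OF IH y] by simp
    consider (absorb) "k \<le> i" | (extend) "Suc i = k" | (commute) "Suc i < k"
      by linarith
    then show ?thesis
    proof cases
      case absorb
      note step
      also have "((y # map c [k..<Suc l]) @ ?f, map c [k..<Suc l] @ ?f) \<in> HK_cong G"
        using chain_absorb_left [OF absorb i(2) assms(1)] V i(1) by (intro HK_suffix) auto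
      finally have 1: "(y # w, map c [k..<Suc l] @ ?f) \<in> HK_cong G" .
      show ?thesis
      proof (cases "y = c l")
        case True
        with 1 k show ?thesis by auto
      next
        case False
        \<comment> \<open>The absorbed letter has to reappear behind the block, since the erased
          word still contains it; absorption read backwards supplies the copy.\<close>
        have "(map c [k..<Suc l] @ ?f, (map c [k..<Suc l] @ [y]) @ ?f) \<in> HK_cong G"
          using chain_absorb_right [OF absorb i(2) assms(1)] V i(1)
          by (intro HK_suffix) (auto intro: HK_cong.sym)
        with 1 False k show ?thesis
          using HK_cong.trans by fastforce
      qed
    next
      case extend
      have "[i..<Suc l] = i # [k..<Suc l]"
        using extend i k upt_conv_Cons [of i "Suc l"] by simp
      then have eq: "y # map c [k..<Suc l] = map c [i..<Suc l]"
        using i by simp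
      \<comment> \<open>Here \<open>y\<close> becomes the first letter of the block and is also
        copied behind it.\<close>
      note step [unfolded eq]
      also have "(map c [i..<Suc l] @ ?f, (map c [i..<Suc l] @ [y]) @ ?f) \<in> HK_cong G"
        using chain_absorb_right [of i i l] i assms(1) V
        by (intro HK_suffix) (auto intro: HK_cong.sym)
      finally have "(y # w, map c [i..<Suc l] @ y # ?f) \<in> HK_cong G"
        by simp
      moreover have "y \<noteq> c l"
        using i extend k assms(1) im by (simp add: c_eq_iff)
      ultimately show ?thesis
        using i by auto
    next
      case commute
      note step
      also have "((y # map c [k..<Suc l]) @ ?f, (map c [k..<Suc l] @ [y]) @ ?f) \<in> HK_cong G"
        using V y i commute assms(1) im c_verts
        by (intro HK_suffix HK_comm_letter) (auto simp: arcs)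
      finally have "(y # w, map c [k..<Suc l] @ y # ?f) \<in> HK_cong G"
        by simp
      moreover have "y \<noteq> c l"
        using i commute k assms(1) im by (simp add: c_eq_iff)
      ultimately show ?thesis
        using k by auto
    qed
  qed
qed auto

text \<open>The path \<open>c k, ..., c l\<close> occurs in the first word, hence in the second. Its
  last letter is missing from \<open>f'\<close>, so the whole path lies in the block that starts at
  \<open>k'\<close>.\<close>

lemma chain_factor_le:
  assumes l: "l < m" and "k \<le> l" "k' \<le> l" and f: "c l \<notin> set f'"
    and same: "same_dpaths G (map c [k..<Suc l] @ f) (map c [k'..<Suc l] @ f')"
  shows "k' \<le> k"
proof -
  have "subseq (map c [k..<Suc l]) (map c [k'..<Suc l] @ f')"
    using same dpath_chain [OF l, of k] unfolding same_dpaths_def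
    by (metis subseq_order.order_refl subseq_rev_drop_many)
  then obtain p q where pq: "map c [k..<Suc l] = p @ q" "subseq p (map c [k'..<Suc l])" "subseq q f'"
    by (rule subseq_appendE)
  have "q = []"
  proof (rule ccontr)
    assume "q \<noteq> []"
    then have "last q = c l"
      using pq(1) \<open>k \<le> l\<close> by (metis last_appendR last_map last_snoc upt_Suc_append append_is_Nil_conv list.distinct(1))
    then show False
      using last_in_set [OF \<open>q \<noteq> []\<close>] subseq_set [OF pq(3)] f by auto
  qed
  then have "set (map c [k..<Suc l]) \<subseteq> set (map c [k'..<Suc l])"
    using pq(1) subseq_set [OF pq(2)] by simp
  moreover have "c k \<in> set (map c [k..<Suc l])"
    using \<open>k \<le> l\<close> by auto
  ultimately obtain j where "c k = c j" "k' \<le> j" "j \<le> l"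
    by auto
  then show ?thesis
    using l \<open>k \<le> l\<close> c_eq_iff [of k j] by simp
qed

text \<open>Factoring off the block ending in the top vertex leaves words over a shorter chain. Two
  applications of \<open>chain_factor_le\<close> show that the blocks agree, and the induction
  hypothesis treats the remaining words.\<close>

lemma dpath_determined_chain_below: "l \<le> m \<Longrightarrow> dpath_determined (c ` {..<l})"
proof (induction l)
  case 0
  then show ?case by (simp add: dpath_determined_def HK_refl)
next
  case (Suc l)
  then have l: "l < m" and IH: "dpath_determined (c ` {..<l})"
    by auto
  show ?case
    unfolding dpath_determined_def
  proof (intro allI impI)
    fix w w' assume "set w \<subseteq> c ` {..<Suc l}" "set w' \<subseteq> c ` {..<Suc l}"
      and same: "same_dpaths G w w'"
    then have w: "set w \<subseteq> c ` {..l}" "set w' \<subseteq> c ` {..l}"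
      by (auto simp: lessThan_Suc_atMost)
    let ?f = "filter (\<lambda>x. x \<noteq> c l)"
    have filter_sub: "set (?f u) \<subseteq> c ` {..<l}" if "set u \<subseteq> c ` {..l}" for u
    proof -
      have "c ` {..l} = insert (c l) (c ` {..<l})"
        by (simp add: lessThan_Suc flip: lessThan_Suc_atMost)
      with that show ?thesis by auto
    qed
    have f: "(?f w, ?f w') \<in> HK_cong G"
      by (intro dpath_determinedD [OF IH] filter_sub w same_dpaths_filter same)
    show "(w, w') \<in> HK_cong G"
    proof (cases "c l \<in> set w")
      case False
      then have "c l \<notin> set w'"
        using same_dpaths_mem [OF same c_mem [OF l]] by simp
      with False have "?f w = w" "?f w' = w'"
        by (auto intro!: filter_True)
      with f show ?thesis by simp
    next
      case True
      then have True': "c l \<in> set w'"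
        using same_dpaths_mem [OF same c_mem [OF l]] by simp
      obtain k where k: "k \<le> l" "(w, map c [k..<Suc l] @ ?f w) \<in> HK_cong G"
        using chain_factor [OF l w(1) True] by auto
      obtain k' where k': "k' \<le> l" "(w', map c [k'..<Suc l] @ ?f w') \<in> HK_cong G"
        using chain_factor [OF l w(2) True'] by auto
      have same': "same_dpaths G (map c [k..<Suc l] @ ?f w) (map c [k'..<Suc l] @ ?f w')"
        using same_dpaths_HK_cong [OF k(2)] same_dpaths_HK_cong [OF k'(2)] same
        by (meson same_dpaths_sym same_dpaths_trans)
      have "k = k'"
        using chain_factor_le [OF l k(1) k'(1) _ same']
          chain_factor_le [OF l k'(1) k(1) _ same_dpaths_sym [OF same']]
        by (intro antisym) auto
      have "(map c [k..<Suc l] @ ?f w, map c [k..<Suc l] @ ?f w') \<in> HK_cong G"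
        using f l c_verts by (intro HK_prefix) auto
      with k(2) k'(2) \<open>k = k'\<close> show ?thesis
        by (meson HK_cong.sym HK_cong.trans)
    qed
  qed
qed

lemma dpath_determined_chain: "dpath_determined (c ` {..<m})"
  by (rule dpath_determined_chain_below) simp

end

section \<open>Arbitrary orientations of a line\<close>

text \<open>Strong induction on the length: an interval is cut at an inner vertex where the
  orientation changes. If there is none, it is a chain read from one of its ends.\<close>

lemma dpath_determined_interval:
  assumes v: "inj_on v {1..n}" "v ` {1..n} \<subseteq> pverts G"
    and one: "\<And>i. i \<in> {1..<n} \<Longrightarrow> ((v i, v (Suc i)) \<in> parcs G) \<noteq> ((v (Suc i), v i) \<in> parcs G)"
    and only: "\<And>i j. i \<in> {1..n} \<Longrightarrow> j \<in> {1..n} \<Longrightarrow> (v i, v j) \<in> parcs G \<Longrightarrow> j = Suc i \<or> i = Suc j"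
    and "1 \<le> a" "a \<le> b" "b \<le> n"
  shows "dpath_determined (v ` {a..b})"
  using assms(5-7)
proof (induction "b - a" arbitrary: a b rule: less_induct)
  case less
  let ?up = "\<lambda>i. (v i, v (Suc i)) \<in> parcs G"
  have v_eq: "v i = v j \<longleftrightarrow> i = j" if "i \<in> {1..n}" "j \<in> {1..n}" for i j
    using v(1) that by (auto dest: inj_onD)
  have vm: "v i \<in> pverts G" if "1 \<le> i" "i \<le> n" for i
    using v(2) that by auto
  show ?case
  proof (cases "\<exists>s. a \<le> s \<and> Suc s < b \<and> ?up s \<noteq> ?up (Suc s)")
    case True
    then obtain s where s: "a \<le> s" "Suc s < b" "?up s \<noteq> ?up (Suc s)"
      by blast
    let ?S = "v ` {a..Suc s}" and ?T = "v ` {Suc s..b}"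
    have "dpath_determined (?S \<union> ?T)"
    proof (rule dpath_determined_glue)
      show "?S \<subseteq> pverts G" "?T \<subseteq> pverts G"
        using less.prems s by (auto intro!: vm)
      show "?S \<inter> ?T = {v (Suc s)}"
        using s less.prems by (auto simp: v_eq)
      show "dpath_determined ?S" "dpath_determined ?T"
        using s less.prems by (intro less.hyps; simp)+
      show "(x, y) \<notin> parcs G \<and> (y, x) \<notin> parcs G"
        if x: "x \<in> ?S - {v (Suc s)}" and y: "y \<in> ?T - {v (Suc s)}" for x y
      proof -
        obtain i where i: "x = v i" "a \<le> i" "i < Suc s"
          using x by (force simp: le_eq_less_or_eq)
        obtain j where j: "y = v j" "Suc s < j" "j \<le> b"
          using y by (force simp: le_eq_less_or_eq)
        show ?thesis
          using only [of i j] only [of j i] i j less.prems by auto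
      qed
      have ST: "?S \<union> ?T = v ` {a..b}"
        using s by (simp add: image_Un [symmetric] ivl_disj_un_two_touch)
      \<comment> \<open>Both arcs at \<open>v (Suc s)\<close> point towards it or both point away,
        and these are all its arcs within the interval.\<close>
      have nbr: "j = s \<or> j = Suc (Suc s)"
        if "j \<in> {a..b}" "(v (Suc s), v j) \<in> parcs G \<or> (v j, v (Suc s)) \<in> parcs G" for j
        using that only [of "Suc s" j] only [of j "Suc s"] s less.prems by auto
      have "s \<in> {1..<n}" "Suc s \<in> {1..<n}"
        using s less.prems by auto
      note one [OF this(1)] one [OF this(2)]
      with s(3) have "(\<forall>j\<in>{a..b}. (v (Suc s), v j) \<notin> parcs G) \<or> (\<forall>j\<in>{a..b}. (v j, v (Suc s)) \<notin> parcs G)"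
        using nbr by (cases "?up s") blast+
      then show "(\<forall>y\<in>?S \<union> ?T. (v (Suc s), y) \<notin> parcs G) \<or> (\<forall>y\<in>?S \<union> ?T. (y, v (Suc s)) \<notin> parcs G)"
        unfolding ST by blast
    qed
    moreover have "?S \<union> ?T = v ` {a..b}"
      using s by (simp add: image_Un [symmetric] ivl_disj_un_two_touch)
    ultimately show ?thesis by simp
  next
    case False
    have const: "?up i = ?up a" if "a \<le> i" "i < b" for i
      using that(1,2)
    proof (induction i rule: dec_induct)
      case (step i)
      then show ?case using False by auto
    qed simp
    show ?thesis
    \<comment> \<open>For \<open>a = b\<close> the test \<open>?up a\<close> concerns no edge of the
      interval; the chain then has one vertex and either branch covers it.\<close>
    proof (cases "?up a")
      case True
      have up: "(v i, v j) \<in> parcs G \<longleftrightarrow> j = Suc i" if "i \<in> {a..b}" "j \<in> {a..b}" for i j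
      proof
        assume "j = Suc i"
        then show "(v i, v j) \<in> parcs G"
          using const [of i] True that by simp
      next
        assume *: "(v i, v j) \<in> parcs G"
        then have "j = Suc i \<or> i = Suc j"
          using only [of i j] that less.prems by auto
        moreover have "i \<noteq> Suc j"
          using const [of j] True that arcD [OF *] by auto
        ultimately show "j = Suc i" by simp
      qed
      have "dpath_determined ((\<lambda>i. v (a + i)) ` {..<Suc (b - a)})"
      proof (rule dpath_determined_chain)
        show "inj_on (\<lambda>i. v (a + i)) {..<Suc (b - a)}"
          using less.prems by (auto simp: inj_on_def v_eq)
        show "(\<lambda>i. v (a + i)) ` {..<Suc (b - a)} \<subseteq> pverts G"
          using less.prems by (auto intro!: vm)
      qed (use less.prems up in auto)
      moreover have "(\<lambda>i. v (a + i)) ` {..<Suc (b - a)} = v ` {a..b}"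
      proof -
        have "(\<lambda>i. a + i) ` {..<Suc (b - a)} = {a..b}"
        proof (intro equalityI subsetI)
          fix j assume "j \<in> {a..b}"
          then have "j = a + (j - a)" "j - a \<in> {..<Suc (b - a)}"
            by auto
          then show "j \<in> (\<lambda>i. a + i) ` {..<Suc (b - a)}"
            by (rule image_eqI)
        qed (use less.prems in auto)
        then show ?thesis by (metis image_image)
      qed
      ultimately show ?thesis by simp
    next
      case False
      have down: "(v i, v j) \<in> parcs G \<longleftrightarrow> i = Suc j" if "i \<in> {a..b}" "j \<in> {a..b}" for i j
      proof
        assume "i = Suc j"
        then show "(v i, v j) \<in> parcs G"
          using const [of j] one [of j] False that less.prems by simp
      next
        assume *: "(v i, v j) \<in> parcs G"
        then have "j = Suc i \<or> i = Suc j"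
          using only [of i j] that less.prems by auto
        moreover have "j \<noteq> Suc i"
          using const [of i] False that * by auto
        ultimately show "i = Suc j" by simp
      qed
      \<comment> \<open>All arcs point to the smaller index, so the chain starts at
        \<open>b\<close>.\<close>
      have "dpath_determined ((\<lambda>i. v (b - i)) ` {..<Suc (b - a)})"
      proof (rule dpath_determined_chain)
        show "inj_on (\<lambda>i. v (b - i)) {..<Suc (b - a)}"
        proof (rule inj_onI)
          fix i j assume ij: "i \<in> {..<Suc (b - a)}" "j \<in> {..<Suc (b - a)}" "v (b - i) = v (b - j)"
          then have "b - i \<in> {1..n}" "b - j \<in> {1..n}" "i \<le> b" "j \<le> b"
            using less.prems by auto
          with ij(3) show "i = j"
            using v_eq [of "b - i" "b - j"] by simp
        qed
        show "(\<lambda>i. v (b - i)) ` {..<Suc (b - a)} \<subseteq> pverts G"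
          using less.prems by (auto intro!: vm)
      qed (use less.prems down in auto)
      moreover have "(\<lambda>i. v (b - i)) ` {..<Suc (b - a)} = v ` {a..b}"
      proof -
        have "(\<lambda>i. b - i) ` {..<Suc (b - a)} = {a..b}"
        proof (intro equalityI subsetI)
          fix j assume "j \<in> {a..b}"
          then have "j = b - (b - j)" "b - j \<in> {..<Suc (b - a)}"
            by auto
          then show "j \<in> (\<lambda>i. b - i) ` {..<Suc (b - a)}"
            by (rule image_eqI)
        qed (use less.prems in auto)
        then show ?thesis by (metis image_image)
      qed
      ultimately show ?thesis by simp
    qed
  qed
qed

section \<open>Uniqueness of directed paths on a line\<close>

text \<open>A path cannot turn back, because opposite arcs are excluded. Positivity of the product
  says that the end lies on the side of the first step, treating both directions at once.\<close>

lemma dpath_index_monotone: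
  fixes d :: "'v \<Rightarrow> int"
  assumes inj: "inj_on d (pverts G)" and step: "\<And>x y. (x, y) \<in> parcs G \<Longrightarrow> \<bar>d x - d y\<bar> = 1"
    and "dpath G (x # y # p)"
  shows "(d (last (y # p)) - d x) * (d y - d x) > 0"
  using assms(3)
proof (induction p arbitrary: x y)
  case Nil
  then have "\<bar>d x - d y\<bar> = 1"
    by (intro step) auto
  then have "d y - d x = 1 \<or> d y - d x = -1"
    by linarith
  then show ?case by auto
next
  case (Cons z p)
  then have xy: "(x, y) \<in> parcs G" and yz: "(y, z) \<in> parcs G"
    by (auto dest: dpath_ConsD)
  then have "x \<noteq> z" "x \<in> pverts G" "z \<in> pverts G"
    using arcD [OF xy] arcD [OF yz] by auto
  then have "d x \<noteq> d z"
    using inj by (auto dest: inj_onD)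
  moreover have "d y - d x = 1 \<or> d y - d x = -1" "d z - d y = 1 \<or> d z - d y = -1"
    using step [OF xy] step [OF yz] by linarith+
  ultimately have "d y - d x = 1 \<and> d z - d y = 1 \<or> d y - d x = -1 \<and> d z - d y = -1"
    by linarith
  moreover have "(d (last (z # p)) - d y) * (d z - d y) > 0"
    using Cons.IH [of y z] Cons.prems by (auto dest: dpath_ConsD)
  ultimately show ?case by auto
qed

definition unique_dpaths :: bool where
  "unique_dpaths \<longleftrightarrow> (\<forall>x p q. dpath G (x # p) \<longrightarrow> dpath G (x # q) \<longrightarrow>
    last (x # p) = last (x # q) \<longrightarrow> p = q)"

lemma unique_dpathsD:
  "unique_dpaths \<Longrightarrow> dpath G (x # p) \<Longrightarrow> dpath G (x # q) \<Longrightarrow> last (x # p) = last (x # q) \<Longrightarrow> p = q"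
  unfolding unique_dpaths_def by blast

text \<open>The position of the end relative to \<open>x\<close> fixes the sign of the first step
  and hence, by injectivity of \<open>d\<close>, the second vertex.\<close>

lemma unique_dpaths_index:
  fixes d :: "'v \<Rightarrow> int"
  assumes inj: "inj_on d (pverts G)" and step: "\<And>x y. (x, y) \<in> parcs G \<Longrightarrow> \<bar>d x - d y\<bar> = 1"
  shows unique_dpaths
proof -
  have mono: "(d (last (y # p)) - d x) * (d y - d x) > 0" if "dpath G (x # y # p)" for x y p
    using inj step that by (rule dpath_index_monotone)
  have "p = q" if "dpath G (x # p)" "dpath G (x # q)" "last (x # p) = last (x # q)" for x p q
    using that
  proof (induction p arbitrary: x q)
    case Nil
    show ?case
    proof (cases q)
      \<comment> \<open>A path with at least one arc does not return to its start, as the product in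
        \<open>mono\<close> would be zero.\<close>
      case (Cons z r)
      then show ?thesis using mono [of x z r] Nil by auto
    qed simp
  next
    case (Cons y p)
    note p = mono [OF Cons.prems(1)]
    show ?case
    proof (cases q)
      case Nil
      then show ?thesis using p Cons.prems by auto
    next
      case q: (Cons z r)
      let ?e = "d (last (x # y # p)) - d x"
      have pos: "?e * (d y - d x) > 0" "?e * (d z - d x) > 0"
        using p mono [of x z r] Cons.prems q by auto
      have arcs: "(x, y) \<in> parcs G" "(x, z) \<in> parcs G"
        using Cons.prems q by auto
      have "d y - d x = 1 \<or> d y - d x = -1" "d z - d x = 1 \<or> d z - d x = -1"
        using step [OF arcs(1)] step [OF arcs(2)] by linarith+
      with pos have "d y = d z"
        by auto
      then have "y = z"
        using inj arcD [OF arcs(1)] arcD [OF arcs(2)] by (auto dest: inj_onD)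
      with Cons.IH [of y r] Cons.prems q show ?thesis
        by (auto dest: dpath_ConsD)
    qed
  qed
  then show ?thesis
    unfolding unique_dpaths_def by blast
qed

section \<open>Matrix coefficients of the operators\<close>

text \<open>Reading \<open>w\<close> from right to left, a token starting at \<open>y\<close> steps
  back along the path \<open>x # p\<close>: the letters of \<open>p\<close> bring it to
  \<open>x\<close>, and no remaining letter \<open>x\<close> moves it on. The tail \<open>p\<close>
  is empty if the token never moves.\<close>

definition arrives :: "'v list \<Rightarrow> 'v \<Rightarrow> 'v \<Rightarrow> bool" where
  "arrives w y x \<longleftrightarrow> (\<exists>p. dpath G (x # p) \<and> last (x # p) = y \<and> subseq p w \<and> \<not> subseq (x # p) w)"

lemma arrives_Cons_self: "\<not> arrives (x # w) y x"
proof
  assume "arrives (x # w) y x"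
  then obtain p where p: "dpath G (x # p)" "subseq p (x # w)" "\<not> subseq p w"
    by (auto simp: arrives_def)
  then obtain q where "p = x # q"
    by (cases p) (auto split: if_splits)
  with p arcD [of x x] show False by simp
qed

text \<open>A tail that needs the new letter \<open>z\<close> has the form \<open>z # q\<close>,
  which is a token at \<open>z\<close> moving on to \<open>x\<close>. Exclusivity ensures that the
  two summands in the coefficient at \<open>x\<close> are never both one, whatever the
  characteristic.\<close>

lemma arrives_Cons_arc:
  assumes "unique_dpaths" and xz: "(x, z) \<in> parcs G"
  shows "arrives (z # w) y x \<longleftrightarrow> arrives w y x \<or> arrives w y z"
    and "\<not> (arrives w y x \<and> arrives w y z)"
proof -
  have ne: "x \<noteq> z" and x: "x \<in> pverts G"
    using arcD [OF xz] by auto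
  show "\<not> (arrives w y x \<and> arrives w y z)"
  proof
    assume "arrives w y x \<and> arrives w y z"
    then obtain p q where p: "dpath G (x # p)" "last (x # p) = y" "subseq p w"
      and q: "dpath G (z # q)" "last (z # q) = y" "\<not> subseq (z # q) w"
      by (auto simp: arrives_def)
    have "p = z # q"
      by (rule unique_dpathsD [OF assms(1) p(1)]) (use p q x xz in auto)
    with p q show False by simp
  qed
  show "arrives (z # w) y x \<longleftrightarrow> arrives w y x \<or> arrives w y z"
  proof
    assume "arrives (z # w) y x"
    then obtain p where p: "dpath G (x # p)" "last (x # p) = y" "subseq p (z # w)" "\<not> subseq (x # p) w"
      using ne by (auto simp: arrives_def)
    show "arrives w y x \<or> arrives w y z"
    proof (cases "subseq p w")
      case True
      with p have "arrives w y x"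
        unfolding arrives_def by blast
      then show ?thesis ..
    next
      case False
      with p(3) obtain q where "p = z # q" "subseq q w"
        by (cases p) (auto split: if_splits)
      with False p have "arrives w y z"
        unfolding arrives_def by (intro exI [of _ q]) (auto dest: dpath_ConsD)
      then show ?thesis ..
    qed
  next
    assume "arrives w y x \<or> arrives w y z"
    then show "arrives (z # w) y x"
    proof
      assume "arrives w y x"
      then obtain p where "dpath G (x # p)" "last (x # p) = y" "subseq p w" "\<not> subseq (x # p) w"
        by (auto simp: arrives_def)
      with ne show ?thesis
        unfolding arrives_def by (intro exI [of _ p]) auto
    next
      assume "arrives w y z"
      then obtain q where "dpath G (z # q)" "last (z # q) = y" "subseq q w" "\<not> subseq (z # q) w"
        by (auto simp: arrives_def)
      with ne x xz show ?thesis
        unfolding arrives_def by (intro exI [of _ "z # q"]) (auto dest: subseq_Cons')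
    qed
  qed
qed

text \<open>The tail of a path from \<open>x\<close> does not begin with \<open>z\<close>, so a
  leading \<open>z\<close> cannot contribute to it.\<close>

lemma arrives_Cons_other:
  assumes "x \<noteq> z" "(x, z) \<notin> parcs G"
  shows "arrives (z # w) y x \<longleftrightarrow> arrives w y x"
proof -
  have "subseq p (z # w) \<longleftrightarrow> subseq p w" if "dpath G (x # p)" for p
    using that assms by (cases p) auto
  with assms(1) show ?thesis
    by (auto simp: arrives_def)
qed

text \<open>By uniqueness of paths, \<open>arrives\<close> at the two ends of \<open>x # p\<close>
  says that \<open>p\<close> is a subsequence and \<open>x # p\<close> is not. Once \<open>p\<close>
  is settled by induction, this decides \<open>x # p\<close>.\<close>

lemma same_dpathsI_arrives:
  assumes unique_dpaths
    and eq: "\<And>x y. x \<in> pverts G \<Longrightarrow> y \<in> pverts G \<Longrightarrow> arrives u y x = arrives w y x"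
  shows "same_dpaths G u w"
proof -
  have "subseq p u = subseq p w" if "dpath G p" for p
    using that
  proof (induction p)
    case (Cons x p)
    then have IH: "subseq p u = subseq p w"
      by (auto dest: dpath_ConsD)
    let ?y = "last (x # p)"
    have x: "x \<in> pverts G" "?y \<in> pverts G"
      using Cons.prems last_in_set [of "x # p"] unfolding dpath_def by auto
    have *: "arrives t ?y x \<longleftrightarrow> subseq p t \<and> \<not> subseq (x # p) t" for t
      using unique_dpathsD [OF assms(1) Cons.prems] Cons.prems unfolding arrives_def by metis
    show ?case
      using eq [OF x] IH subseq_Cons' unfolding * by metis
  qed simp
  then show ?thesis
    by (simp add: same_dpaths_def)
qed

end

text \<open>The coordinate formula for \<open>theta\<close> is the recursion that the three lemmas
  on \<open>arrives (z # w)\<close> establish.\<close>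

lemma (in HK_weighted) word_rep_coord:
  assumes f: "f = (\<lambda>_. \<one>)" and uniq: unique_dpaths
    and y: "y \<in> V" and w: "set w \<subseteq> V" and x: "x \<in> V"
  shows "word_rep R G f w (basis_vec R V y) x = (if arrives w y x then \<one> else \<zero>)"
  using w x
proof (induction w arbitrary: x)
  case Nil
  have "arrives [] y x \<longleftrightarrow> x = y"
    using Nil by (auto simp: arrives_def dest: list_emb_Nil2)
  with Nil show ?case
    by (simp add: word_rep_apply basis_closed) (use y in \<open>auto simp: basis_vec_def\<close>)
next
  case (Cons z w)
  let ?a = "word_rep R G f w (basis_vec R V y)"
  have z: "z \<in> V" and w: "w \<in> lists V"
    using Cons.prems by auto
  have a: "?a \<in> carrier W"
    using word_rep_closed [OF w] basis_closed by (auto simp: End_monoid_def)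
  have IH: "?a t = (if arrives w y t then \<one> else \<zero>)" if "t \<in> V" for t
    using Cons that by auto
  have coord: "word_rep R G f (z # w) (basis_vec R V y) x =
      (if x = z then \<zero> else if (x, z) \<in> parcs G then ?a x \<oplus> ?a z \<otimes> f (x, z) else ?a x)"
    using theta_coord [OF a z Cons.prems(2)] by (simp add: word_rep_apply basis_closed)
  consider (self) "x = z" | (arc) "x \<noteq> z" "(x, z) \<in> parcs G" | (other) "x \<noteq> z" "(x, z) \<notin> parcs G"
    by blast
  then show ?case
  proof cases
    case self
    then show ?thesis using coord arrives_Cons_self by simp
  next
    case arc
    then show ?thesis
      unfolding coord using arrives_Cons_arc [OF uniq arc(2), of w y] IH z Cons.prems f by auto
  next
    case other
    then show ?thesis
      unfolding coord using arrives_Cons_other [OF other, of w y] IH Cons.prems by simp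
  qed
qed

theorem corollary4p6:
  fixes R :: "('r, 'm) ring_scheme" (structure)
    and G :: "'v pair_pre_digraph" and n :: nat
  assumes "domain R" and "n \<ge> 1" and "type_A n G"
  shows "inj_on (HK_rep R G (\<lambda>_. \<one>)) (carrier (HK G))"
proof -
  interpret domain R by fact
  interpret HK_weighted G R "\<lambda>_. \<one>"
    using assms(3) by (rule HK_weighted_one)
  obtain v where bij: "bij_betw v {1..n} (pverts G)"
    and ones: "\<forall>i\<in>{1..<n}. ((v i, v (Suc i)) \<in> parcs G) \<noteq> ((v (Suc i), v i) \<in> parcs G)"
    and onlys: "\<forall>(x, y)\<in>parcs G. \<exists>i\<in>{1..<n}. {x, y} = {v i, v (Suc i)}"
    using assms(3) unfolding type_A_def by (elim exE conjE)
  have only: "\<exists>i\<in>{1..<n}. {x, y} = {v i, v (Suc i)}" if "(x, y) \<in> parcs G" for x y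
    using bspec [OF onlys that] by simp
  have inj: "inj_on v {1..n}" and surj: "v ` {1..n} = V"
    using bij by (auto simp: bij_betw_def)
  \<comment> \<open>The position of a vertex along the line, which changes by exactly one along
    every arc.\<close>
  define d where "d = inv_into {1..n} v"
  have d: "d (v i) = i" if "i \<in> {1..n}" for i
    using inj that by (simp add: d_def)
  have step: "d y = Suc (d x) \<or> d x = Suc (d y)" if xy: "(x, y) \<in> parcs G" for x y
  proof -
    obtain i where i: "i \<in> {1..<n}" "{x, y} = {v i, v (Suc i)}"
      using only [OF xy] by blast
    then show ?thesis
      using d [of i] d [of "Suc i"] by (auto simp: doubleton_eq_iff)
  qed
  have uniq: unique_dpaths
  proof (rule unique_dpaths_index)
    show "inj_on (\<lambda>x. int (d x)) V"
      using inj_on_inv_into [of V v "{1..n}"] surj by (auto simp: inj_on_def d_def)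
    show "\<bar>int (d x) - int (d y)\<bar> = 1" if "(x, y) \<in> parcs G" for x y
      using step [OF that] by auto
  qed
  have "dpath_determined (v ` {1..n})"
  proof (rule dpath_determined_interval [OF inj])
    show "j = Suc i \<or> i = Suc j" if "i \<in> {1..n}" "j \<in> {1..n}" "(v i, v j) \<in> parcs G" for i j
      using step [OF that(3)] d that by simp
  qed (use surj ones assms(2) in auto)
  then have det: "dpath_determined V"
    by (simp only: surj)
  show ?thesis
  proof (rule inj_onI)
    fix A B
    assume "A \<in> carrier (HK G)" "B \<in> carrier (HK G)"
      and eq: "HK_rep R G (\<lambda>_. \<one>) A = HK_rep R G (\<lambda>_. \<one>) B"
    then obtain u w where u: "u \<in> lists V" "A = HK_class G u"
      and w: "w \<in> lists V" "B = HK_class G w"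
      unfolding carrier_HK by blast
    have uw: "set u \<subseteq> V" "set w \<subseteq> V"
      using u w by auto
    have rep: "word_rep R G (\<lambda>_. \<one>) u = word_rep R G (\<lambda>_. \<one>) w"
      using eq u w by (simp add: HK_rep_class)
    have "same_dpaths G u w"
    proof (rule same_dpathsI_arrives [OF uniq])
      fix x y assume xy: "x \<in> V" "y \<in> V"
      \<comment> \<open>Equal operators have equal coefficients at \<open>x\<close> on the basis
        vector of \<open>y\<close>; in a domain one differs from zero, so \<open>arrives\<close> can
        be read off.\<close>
      have "(if arrives u y x then \<one> else \<zero>) = (if arrives w y x then \<one> else \<zero>)"
        using word_rep_coord [OF HOL.refl uniq xy(2) uw(1) xy(1)]
          word_rep_coord [OF HOL.refl uniq xy(2) uw(2) xy(1)] rep by simp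
      then show "arrives u y x = arrives w y x"
        by (auto split: if_splits)
    qed
    then have "(u, w) \<in> HK_cong G"
      using det uw by (intro dpath_determinedD)
    then show "A = B"
      using u w by (simp add: HK_class_eq_iff)
  qed
qed

end
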